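(* Let $k\ge 1$ be an integer and let $\mathcal{X},\mathcal{Y}$ be finite sets with $1<|\mathcal{Y}|\le|\mathcal{X}|$. Let $\mathbf{X}=(X_n)_{n\in\mathbb{N}_0}$ be a first-order homogeneous Markov chain on $\mathcal{X}$ with transition matrix $\mathbf{P}$, having a single recurrent class and invariant distribution $\pi$, and let $\mathbf{X}$ be stationary, i.e., $p_{X_0}=\pi$. Let $g:\mathcal{X}\to\mathcal{Y}$ be a function ($g$ may be non-injective). Define the process $\mathbf{Y}=(Y_n)_{n\in\mathbb{N}_0}$ by $Y_n=g(X_n)$, and let $\mathbf{Z}$, with transition matrix $\mathbf{Q}$, be the $k$-th order Markov approximation of $\mathbf{Y}$. Then $\mathbf{Z}$ has a unique invariant distribution $\mu$ on $\mathcal{Y}^k$, and it satisfies $$\forall y_0^{k-1}\in\mathcal{Y}^k:\quad \mu_{y_0^{k-1}} = p_{Y_0^{k-1}}(y_0^{k-1}) = \sum_{x_0^{k-1}\in g^{-1}(y_0^{k-1})} \pi_{x_0}\prod_{\ell=1}^{k-1} P_{x_{\ell-1}\to x_\ell}.$$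
   Context: Notation: $z_a^b=(z_a,\dots,z_b)$, and similarly for random variables; $p_Z(z)=\mathbb{P}(Z=z)$, and $p_{Z_1|Z_2}$ denotes conditional probabilities. Functions on an alphabet are extended to vectors coordinate-wise, and $g^{-1}(y_0^{k-1})=g^{-1}(y_0)\times\cdots\times g^{-1}(y_{k-1})$. Markov chains: A $k$-th order homogeneous Markov chain $\mathbf{Z}=(Z_n)_{n\in\mathbb{N}_0}$ on a finite alphabet $\mathcal{Z}$ with transition matrix $\mathbf{Q}$ (a $|\mathcal{Z}|^k\times|\mathcal{Z}|$ row-stochastic matrix with entries $Q_{z_0^{k-1}\to z_k}$) is a process with $p_{Z_n|Z_0^{n-1}}(z_n|z_0^{n-1})=p_{Z_n|Z_{n-k}^{n-1}}(z_n|z_{n-k}^{n-1})=Q_{z_{n-k}^{n-1}\to z_n}$ for all $n\ge k$ and all $z_0^n\in\mathcal{Z}^{n+1}$. Recurrent classes of a first-order chain: $z$ is accessible from $z'$ ($z'\to z$) if some $n\ge1$ has $n$-step transition probability from $z'$ to $z$ positive; $z,z'$ communicate if $z\to z'$ and $z'\to z$; $z$ is recurrent if $z\to z'$ implies $z'\to z$, and transient otherwise; a recurrent class is a communication class of recurrent states. Invariant distribution: A probability distribution $\mu$ on $\mathcal{Z}^k$ is invariant for a $k$-th order chain with transition matrix $\mathbf{Q}$ if and only if for all $z_1^k\in\mathcal{Z}^k$: $\mu_{z_1^k}=\sum_{z_0\in\mathcal{Z}}\mu_{z_0^{k-1}}Q_{z_0^{k-1}\to z_k}$. Markov approximation: For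 a stationary process $\mathbf{W}$ on a finite alphabet $\mathcal{Z}$, its $k$-th order Markov approximation is a $k$-th order homogeneous Markov chain on $\mathcal{Z}$ with transition matrix $\mathbf{Q}$ given, for all $z_0^k\in\mathcal{Z}^{k+1}$, by $Q_{z_0^{k-1}\to z_k}=p_{W_0^k}(z_0^k)/p_{W_0^{k-1}}(z_0^{k-1})$ if $p_{W_0^{k-1}}(z_0^{k-1})>0$, and $Q_{z_0^{k-1}\to z_k}=1/|\mathcal{Z}|$ otherwise. *)

theory Defs
  imports "HOL-Probability.Probability"
begin

(* Elements of Z^k are lists of length k; block z m n is the word (z_m, ..., z_{n-1}). *)
definition block :: "(nat \<Rightarrow> 'z) \<Rightarrow> nat \<Rightarrow> nat \<Rightarrow> 'z list" where
  "block z m n = map z [m..<n]"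

definition row_stochastic :: "nat \<Rightarrow> ('z::finite list \<Rightarrow> 'z \<Rightarrow> real) \<Rightarrow> bool" where
  "row_stochastic k Q \<longleftrightarrow>
     (\<forall>w. length w = k \<longrightarrow> (\<forall>z. 0 \<le> Q w z) \<and> (\<Sum>z\<in>UNIV. Q w z) = 1)"

(* The Markov identities are required for every history of positive probability, that is,
   whenever the conditional probabilities are defined: cond_prob is 0 on null conditions.
   Rows of Q indexed by lists of length other than k are irrelevant. *)
definition homogeneous_markov_chain ::
  "nat \<Rightarrow> 'a measure \<Rightarrow> (nat \<Rightarrow> 'a \<Rightarrow> 'z::finite) \<Rightarrow> ('z list \<Rightarrow> 'z \<Rightarrow> real) \<Rightarrow> bool" where
  "homogeneous_markov_chain k M Z Q \<longleftrightarrow>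
     prob_space M \<and> (\<forall>n. Z n \<in> measurable M (count_space UNIV)) \<and> row_stochastic k Q \<and>
     (\<forall>n\<ge>k. \<forall>z. \<P>(\<omega> in M. block (\<lambda>i. Z i \<omega>) 0 n = block z 0 n) > 0 \<longrightarrow>
        \<P>(\<omega> in M. Z n \<omega> = z n \<bar> block (\<lambda>i. Z i \<omega>) 0 n = block z 0 n)
          = \<P>(\<omega> in M. Z n \<omega> = z n \<bar> block (\<lambda>i. Z i \<omega>) (n - k) n = block z (n - k) n) \<and>
        \<P>(\<omega> in M. Z n \<omega> = z n \<bar> block (\<lambda>i. Z i \<omega>) (n - k) n = block z (n - k) n)
          = Q (block z (n - k) n) (z n))"

(* A square matrix as the transition matrix of a first-order chain, identifying Z^1 with Z. *)
definition first_order :: "('z \<Rightarrow> 'z \<Rightarrow> real) \<Rightarrow> 'z list \<Rightarrow> 'z \<Rightarrow> real" where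
  "first_order P w z = P (hd w) z"

(* For w = (z_1, ..., z_k), the list z0 # butlast w is (z_0, ..., z_{k-1}). Being a pmf supported
   on the lists of length k, an invariant distribution has no values left unspecified. *)
definition invariant_distribution ::
  "nat \<Rightarrow> ('z::finite list \<Rightarrow> 'z \<Rightarrow> real) \<Rightarrow> 'z list pmf \<Rightarrow> bool" where
  "invariant_distribution k Q \<mu> \<longleftrightarrow>
     set_pmf \<mu> \<subseteq> {w. length w = k} \<and>
     (\<forall>w. length w = k \<longrightarrow>
        pmf \<mu> w = (\<Sum>z0\<in>UNIV. pmf \<mu> (z0 # butlast w) * Q (z0 # butlast w) (last w)))"

fun nstep_prob :: "('z::finite \<Rightarrow> 'z \<Rightarrow> real) \<Rightarrow> nat \<Rightarrow> 'z \<Rightarrow> 'z \<Rightarrow> real" where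
  "nstep_prob P 0 x y = (if x = y then 1 else 0)"
| "nstep_prob P (Suc n) x y = (\<Sum>z\<in>UNIV. P x z * nstep_prob P n z y)"

definition leads_to :: "('z::finite \<Rightarrow> 'z \<Rightarrow> real) \<Rightarrow> 'z \<Rightarrow> 'z \<Rightarrow> bool" where
  "leads_to P x y \<longleftrightarrow> (\<exists>n\<ge>1. nstep_prob P n x y > 0)"

definition communicate :: "('z::finite \<Rightarrow> 'z \<Rightarrow> real) \<Rightarrow> 'z \<Rightarrow> 'z \<Rightarrow> bool" where
  "communicate P x y \<longleftrightarrow> leads_to P x y \<and> leads_to P y x"

definition recurrent :: "('z::finite \<Rightarrow> 'z \<Rightarrow> real) \<Rightarrow> 'z \<Rightarrow> bool" where
  "recurrent P x \<longleftrightarrow> (\<forall>y. leads_to P x y \<longrightarrow> leads_to P y x)"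

(* As accessibility takes at least one step, a transient state need not communicate with itself;
   recurrent states of a stochastic matrix always do. *)
definition recurrent_class :: "('z::finite \<Rightarrow> 'z \<Rightarrow> real) \<Rightarrow> 'z set \<Rightarrow> bool" where
  "recurrent_class P C \<longleftrightarrow>
     (\<exists>x\<in>C. C = {y. communicate P x y}) \<and> (\<forall>x\<in>C. recurrent P x)"

(* W lives on M; the approximating chain Z, with transition matrix Q, may live on another
   space N. The initial distribution of Z is unconstrained. *)
definition markov_approximation ::
  "nat \<Rightarrow> 'a measure \<Rightarrow> (nat \<Rightarrow> 'a \<Rightarrow> 'z::finite) \<Rightarrow>
   'b measure \<Rightarrow> (nat \<Rightarrow> 'b \<Rightarrow> 'z) \<Rightarrow> ('z list \<Rightarrow> 'z \<Rightarrow> real) \<Rightarrow> bool" where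
  "markov_approximation k M W N Z Q \<longleftrightarrow>
     homogeneous_markov_chain k N Z Q \<and>
     (\<forall>w z. length w = k \<longrightarrow>
        Q w z =
          (if \<P>(\<omega> in M. block (\<lambda>i. W i \<omega>) 0 k = w) > 0
           then \<P>(\<omega> in M. block (\<lambda>i. W i \<omega>) 0 (Suc k) = w @ [z])
                  / \<P>(\<omega> in M. block (\<lambda>i. W i \<omega>) 0 k = w)
           else 1 / real CARD('z)))"

end

theory Submission imports Defs begin

text \<open>
  Write $q(w)$ for the probability that the observed process \<open>Y\<close> starts with the word \<open>w\<close>. Both
  claims about \<open>Q\<close> follow from two properties of \<open>q\<close>: it is consistent under summing out the first
  or the last letter (stationarity), and any two words of positive probability occur, the second
  somewhere after the first, in one longer word of positive probability (irreducibility).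

  Existence is stationarity alone. Since \<open>Q\<close> is a ratio of word probabilities,
  $q(w)\,Q_{w \to z} = q(wz)$ for every word \<open>w\<close> of length \<open>k\<close>; summing over the first letter of \<open>w\<close>
  turns this into the invariance of \<open>q\<close> (\<open>word_pmf_invariant\<close>).

  Uniqueness needs that in the graph of positive \<open>Q\<close>-transitions every word of length \<open>k\<close>, charged
  by \<open>q\<close> or not, leads to every charged word \<open>w\<^sub>0\<close> (\<open>reaches_charged_word\<close>). From a charged word,
  irreducibility supplies a long word of positive probability, and sliding a window of length \<open>k\<close>
  along it uses only positive transitions. From a word of probability zero all transitions are
  uniform, so the letters of \<open>w\<^sub>0\<close> may be appended one by one until either \<open>w\<^sub>0\<close> or another charged
  word appears. Given an invariant distribution \<open>\<nu>\<close>, let \<open>r\<close> be the minimum of the ratio $\nu/q$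
  over charged words. Then $\nu - r q$ is invariant and nonnegative and vanishes at a charged word,
  hence at all its predecessors, hence everywhere (\<open>invariant_vector_zero\<close>). As \<open>\<nu>\<close> and \<open>q\<close> both
  have total mass one, \<open>r\<close> is one.

  It remains to obtain the two properties from the hidden chain, whose word probabilities are the
  path weights $\pi_{x_0} \prod P_{x_{l-1} \to x_l}$. Stationarity is the invariance of \<open>\<pi>\<close> and
  passes to the image under \<open>g\<close>, as does irreducibility. For the latter, states charged by \<open>\<pi>\<close> are
  recurrent: the set of states accessible from a given state is closed, and in equilibrium no mass
  can flow into a closed set (\<open>step_returns\<close>). With a single recurrent class, all charged states
  therefore lead to each other (\<open>charged_communicate\<close>), and paths of positive weight can be
  joined.
\<close>

section \<open>Word laws of stationary processes\<close>

text \<open>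
  The two summation rules are the Kolmogorov consistency condition and shift invariance of the law
  of a stationary process, expressed through its finite-dimensional probabilities.
\<close>

locale stationary_word_law =
  fixes q :: "'z::finite list \<Rightarrow> real"
  assumes nonneg: "0 \<le> q w"
    and Nil_eq: "q [] = 1"
    and sum_Cons: "(\<Sum>z\<in>UNIV. q (z # w)) = q w"
    and sum_snoc: "(\<Sum>z\<in>UNIV. q (w @ [z])) = q w"
begin

lemma suffix_pos:
  assumes "q (v @ w) > 0"
  shows "q w > 0"
  using assms
proof (induction v)
  case (Cons a v)
  have "q (a # v @ w) \<le> (\<Sum>z\<in>UNIV. q (z # v @ w))"
    by (rule member_le_sum) (auto simp: nonneg)
  with Cons show ?case by (simp add: sum_Cons)
qed simp

lemma prefix_pos:
  assumes "q (w @ v) > 0"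
  shows "q w > 0"
  using assms
proof (induction v rule: rev_induct)
  case (snoc a v)
  have "q ((w @ v) @ [a]) \<le> (\<Sum>z\<in>UNIV. q ((w @ v) @ [z]))"
    by (rule member_le_sum) (auto simp: nonneg)
  with snoc show ?case by (simp only: sum_snoc) simp
qed simp

lemma finite_words: "finite {w :: 'z list. length w = n}"
  using finite_lists_length_eq[of "UNIV :: 'z set" n] by simp

lemma sum_words: "(\<Sum>w | length w = n. q w) = 1"
proof (induction n)
  case 0
  show ?case by (simp add: Nil_eq)
next
  case (Suc n)
  have "{w :: 'z list. length w = Suc n} = (\<lambda>(z, w). z # w) ` (UNIV \<times> {w. length w = n})"
    by (force simp: length_Suc_conv)
  moreover have "inj_on (\<lambda>(z, w). z # w) (UNIV \<times> {w :: 'z list. length w = n})"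
    by (auto simp: inj_on_def)
  ultimately have "(\<Sum>w | length w = Suc n. q w) =
      (\<Sum>(z, w)\<in>UNIV \<times> {w. length w = n}. q (z # w))"
    by (simp add: sum.reindex case_prod_unfold)
  also have "\<dots> = (\<Sum>w | length w = n. \<Sum>z\<in>UNIV. q (z # w))"
    by (subst sum.swap) (simp add: sum.cartesian_product)
  finally show ?case by (simp add: sum_Cons Suc.IH)
qed

definition word_pmf :: "nat \<Rightarrow> 'z list pmf" where
  "word_pmf n = embed_pmf (\<lambda>w. if length w = n then q w else 0)"

lemma pmf_word_pmf: "pmf (word_pmf n) w = (if length w = n then q w else 0)"
  unfolding word_pmf_def
proof (rule pmf_embed_pmf)
  let ?f = "\<lambda>w :: 'z list. if length w = n then q w else 0"
  have "(\<integral>\<^sup>+ w. ennreal (?f w) \<partial>count_space UNIV)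
      = (\<Sum>w | length w = n. ennreal (?f w))"
    by (rule nn_integral_count_space'[OF finite_words]) auto
  also have "\<dots> = ennreal (\<Sum>w | length w = n. q w)"
    by (simp add: nonneg sum_ennreal)
  finally show "(\<integral>\<^sup>+ w. ennreal (?f w) \<partial>count_space UNIV) = 1"
    by (simp add: sum_words)
qed (simp add: nonneg)

end

section \<open>Markov approximation of an irreducible word law\<close>

text \<open>
  Irreducibility is a property of words, not of single letters: for the image of a Markov chain
  under a non-injective map, a path from letter to letter would not control the words of length \<open>k\<close>
  that are the states of the approximation.
\<close>

locale word_law_approximation = stationary_word_law q
  for q :: "'z::finite list \<Rightarrow> real" +
  fixes k :: nat and Q :: "'z list \<Rightarrow> 'z \<Rightarrow> real"
  assumes k_pos: "k \<ge> 1"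
    and irreducible:
      "\<lbrakk>v \<noteq> []; w \<noteq> []; q v > 0; q w > 0\<rbrakk> \<Longrightarrow> \<exists>u. q (v @ u @ w) > 0"
    and Q_eq: "length w = k \<Longrightarrow>
      Q w z = (if q w > 0 then q (w @ [z]) / q w else 1 / real CARD('z))"
begin

text \<open>
  The transition graph of the first-order chain on words of length \<open>k\<close> that \<open>Q\<close> induces.
\<close>

definition word_graph :: "('z list \<times> 'z list) set" where
  "word_graph = {(w, tl w @ [z]) | w z. length w = k \<and> Q w z > 0}"

lemma mult_Q:
  assumes "length w = k"
  shows "q w * Q w z = q (w @ [z])"
proof (cases "q w > 0")
  case True
  then show ?thesis using assms by (simp add: Q_eq)
next
  case False
  moreover from False have "\<not> q (w @ [z]) > 0"
    using prefix_pos by blast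
  ultimately have "q w = 0" "q (w @ [z]) = 0"
    using nonneg[of w] nonneg[of "w @ [z]"] by linarith+
  then show ?thesis by simp
qed

lemma word_pmf_invariant: "invariant_distribution k Q (word_pmf k)"
  unfolding invariant_distribution_def
proof (intro conjI allI impI)
  show "set_pmf (word_pmf k) \<subseteq> {w. length w = k}"
    by (auto simp: set_pmf_iff pmf_word_pmf split: if_splits)
next
  fix w :: "'z list"
  assume w: "length w = k"
  then have "w \<noteq> []" using k_pos by auto
  then have "q ((z # butlast w) @ [last w]) = q (z # w)" for z by simp
  moreover have len: "length (z # butlast w) = k" for z using w k_pos by simp
  ultimately have "q (z # butlast w) * Q (z # butlast w) (last w) = q (z # w)" for z
    using mult_Q[of "z # butlast w" "last w"] by simp
  then show "pmf (word_pmf k) w =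
      (\<Sum>z\<in>UNIV. pmf (word_pmf k) (z # butlast w) * Q (z # butlast w) (last w))"
    using w len by (simp add: pmf_word_pmf sum_Cons del: length_Cons)
qed

text \<open>
  Sliding a window of length \<open>k\<close> along a word of positive probability uses only positive transitions,
  because the window and the next letter form a factor of that word, and factors of words of positive
  probability have positive probability by stationarity.
\<close>

lemma word_graph_along:
  assumes "length w = k" and "q (w @ u) > 0"
  shows "(w, drop (length u) (w @ u)) \<in> word_graph\<^sup>*"
  using assms(2)
proof (induction u rule: rev_induct)
  case Nil
  show ?case by simp
next
  case (snoc z u)
  define v where "v = drop (length u) (w @ u)"
  have len: "length v = k" using assms(1) by (simp add: v_def)
  have decomp: "w @ u @ [z] = take (length u) (w @ u) @ v @ [z]"
    unfolding v_def by (metis append_assoc append_take_drop_id)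
  have "q (v @ [z]) > 0"
    using snoc.prems suffix_pos unfolding decomp by blast
  moreover from this have "q v > 0" by (rule prefix_pos)
  ultimately have "Q v z > 0" using len by (simp add: Q_eq)
  then have "(v, tl v @ [z]) \<in> word_graph"
    unfolding word_graph_def using len by blast
  moreover have "tl v @ [z] = drop (length (u @ [z])) (w @ u @ [z])"
  proof -
    have "tl v = drop (Suc (length u)) (w @ u)" by (simp add: v_def drop_Suc tl_drop del: drop_append)
    then show ?thesis using assms(1) k_pos by (simp del: drop_Suc_Cons)
  qed
  moreover have "(w, v) \<in> word_graph\<^sup>*"
    unfolding v_def using snoc.prems prefix_pos[of "w @ u" "[z]"] by (intro snoc.IH) simp
  ultimately show ?case by (metis rtrancl.rtrancl_into_rtrancl)
qed

text \<open>
  This is where the uniform rows of \<open>Q\<close> matter: they keep words of probability zero from forming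
  closed sets of their own, each of which would carry a further invariant distribution.
\<close>

lemma reaches_charged_word:
  assumes w: "length w = k" and w0: "length w0 = k" "q w0 > 0"
  shows "(w, w0) \<in> word_graph\<^sup>*"
proof -
  have charged: "(v, w0) \<in> word_graph\<^sup>*" if v: "length v = k" "q v > 0" for v
  proof -
    have "v \<noteq> []" "w0 \<noteq> []" using v w0 k_pos by auto
    then obtain u where "q (v @ u @ w0) > 0" using irreducible v w0 by blast
    from word_graph_along[OF v(1) this] show ?thesis using v(1) w0(1) by simp
  qed
  \<comment> \<open>The word reached after appending the first \<open>j\<close> letters of \<open>w0\<close>; at \<open>j = k\<close> it is \<open>w0\<close> itself,
    so the induction runs downwards from there.\<close>
  have "(drop j w @ take j w0, w0) \<in> word_graph\<^sup>*" if "j \<le> k" for j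
    using that
  proof (induction rule: inc_induct)
    case base
    show ?case using w w0 by simp
  next
    case (step j)
    define v where "v = drop j w @ take j w0"
    have len: "length v = k" using w w0 step.hyps by (simp add: v_def)
    show ?case
    proof (cases "q v > 0")
      case True
      then show ?thesis using charged len by (simp add: v_def)
    next
      case False
      then have "Q v (w0 ! j) > 0" using len by (simp add: Q_eq)
      then have "(v, tl v @ [w0 ! j]) \<in> word_graph"
        unfolding word_graph_def using len by blast
      moreover have "tl v @ [w0 ! j] = drop (Suc j) w @ take (Suc j) w0"
        using w w0 step.hyps by (simp add: v_def drop_Suc tl_drop take_Suc_conv_app_nth)
      ultimately show ?thesis
        using step.IH unfolding v_def by (metis converse_rtrancl_into_rtrancl)
    qed
  qed
  from this[of 0] show ?thesis by simp
qed

text \<open>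
  A zero of a nonnegative invariant vector spreads backwards along the graph: the value at a word is
  a sum of nonnegative inflows, so the value at each predecessor vanishes too.
\<close>

lemma invariant_vector_zero:
  assumes nonneg: "\<And>w. length w = k \<Longrightarrow> 0 \<le> \<eta> w"
    and inv: "\<And>w. length w = k \<Longrightarrow>
      \<eta> w = (\<Sum>z\<in>UNIV. \<eta> (z # butlast w) * Q (z # butlast w) (last w))"
    and w0: "length w0 = k" "q w0 > 0" "\<eta> w0 = 0"
    and w: "length w = k"
  shows "\<eta> w = 0"
proof -
  have "length w = k \<and> \<eta> w = 0" if "(w, w0) \<in> word_graph\<^sup>*" for w
    using that
  proof (induction rule: converse_rtrancl_induct)
    case base
    show ?case using w0 by simp
  next
    case (step v v')
    then obtain z where v: "length v = k" "Q v z > 0" "v' = tl v @ [z]" and zero: "\<eta> v' = 0"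
      by (auto simp: word_graph_def)
    have len: "length (a # butlast v') = k" for a using v k_pos by simp
    have "v \<noteq> []" using v(1) k_pos by auto
    then have hd: "hd v # butlast v' = v" "last v' = z" using v(3) by simp_all
    have Q_nonneg: "0 \<le> Q u a" if "length u = k" for u a
      using that stationary_word_law.nonneg[OF stationary_word_law_axioms] by (simp add: Q_eq)
    have "\<eta> (hd v # butlast v') * Q (hd v # butlast v') (last v')
        \<le> (\<Sum>a\<in>UNIV. \<eta> (a # butlast v') * Q (a # butlast v') (last v'))"
      by (rule member_le_sum)
        (use len nonneg Q_nonneg in \<open>auto simp del: length_Cons length_butlast\<close>)
    also have "\<dots> = \<eta> v'" by (rule inv[symmetric]) (use v k_pos in simp)
    finally have "\<eta> v * Q v z \<le> 0" using hd zero by simp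
    then have "\<eta> v \<le> 0" using v(2) by (simp add: mult_le_0_iff)
    then show ?case using nonneg v(1) by force
  qed
  then show ?thesis using reaches_charged_word[OF w w0(1,2)] by blast
qed

lemma invariant_distribution_unique:
  assumes inv: "invariant_distribution k Q \<nu>"
  shows "\<nu> = word_pmf k"
proof -
  let ?A = "{w :: 'z list. length w = k}"
  define S where "S = {w. length w = k \<and> q w > 0}"
  have finS: "finite S" unfolding S_def by (rule finite_subset[OF _ finite_words[of k]]) auto
  have "S \<noteq> {}"
  proof
    assume "S = {}"
    then have "q w = 0" if "length w = k" for w
      using that nonneg[of w] by (force simp: S_def)
    then show False using sum_words[of k] by simp
  qed
  define r where "r = Min ((\<lambda>w. pmf \<nu> w / q w) ` S)"
  have "r \<in> (\<lambda>w. pmf \<nu> w / q w) ` S"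
    unfolding r_def using finS \<open>S \<noteq> {}\<close> by (intro Min_in) auto
  then obtain w0 where w0: "w0 \<in> S" "r = pmf \<nu> w0 / q w0" by blast
  define \<eta> where "\<eta> w = pmf \<nu> w - r * q w" for w
  have "0 \<le> \<eta> w" if "length w = k" for w
  proof (cases "q w > 0")
    case True
    then have "r \<le> pmf \<nu> w / q w"
      unfolding r_def using that finS by (intro Min_le) (auto simp: S_def)
    then show ?thesis using True by (simp add: \<eta>_def field_simps)
  next
    case False
    then have "q w = 0" using nonneg[of w] by linarith
    then show ?thesis by (simp add: \<eta>_def)
  qed
  moreover have "\<eta> w = (\<Sum>z\<in>UNIV. \<eta> (z # butlast w) * Q (z # butlast w) (last w))"
    if w: "length w = k" for w
  proof -
    have "length (z # butlast w) = k" for z using w k_pos by simp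
    then have "q w = (\<Sum>z\<in>UNIV. q (z # butlast w) * Q (z # butlast w) (last w))"
      using word_pmf_invariant w
      by (simp add: invariant_distribution_def pmf_word_pmf del: length_Cons length_butlast)
    moreover have "pmf \<nu> w = (\<Sum>z\<in>UNIV. pmf \<nu> (z # butlast w) * Q (z # butlast w) (last w))"
      using inv w unfolding invariant_distribution_def by blast
    ultimately show ?thesis
      by (simp add: \<eta>_def left_diff_distrib sum_subtractf sum_distrib_left mult.assoc)
  qed
  moreover have "length w0 = k" "q w0 > 0" "\<eta> w0 = 0"
    using w0 by (auto simp: S_def \<eta>_def)
  ultimately have "\<eta> w = 0" if "length w = k" for w
    using invariant_vector_zero[of \<eta> w0 w] that by blast
  then have proportional: "pmf \<nu> w = r * q w" if "length w = k" for w
    using that by (simp add: \<eta>_def)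
  have supp: "set_pmf \<nu> \<subseteq> ?A" using inv by (simp add: invariant_distribution_def)
  have "1 = (\<Sum>w\<in>?A. pmf \<nu> w)" using sum_pmf_eq_1[OF finite_words supp] by simp
  also have "\<dots> = r" using sum_words[of k] by (simp add: proportional flip: sum_distrib_left)
  finally have "r = 1" by simp
  show ?thesis
  proof (rule pmf_eqI)
    fix w
    show "pmf \<nu> w = pmf (word_pmf k) w"
      using proportional[of w] \<open>r = 1\<close> supp by (auto simp: pmf_word_pmf pmf_eq_0_set_pmf)
  qed
qed

end

section \<open>Accessibility and the support of an invariant distribution\<close>

definition edges :: "('x \<Rightarrow> 'x \<Rightarrow> real) \<Rightarrow> ('x \<times> 'x) set" where
  "edges P = {(x, y). P x y > 0}"

lemma nstep_prob_nonneg: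
  assumes "\<And>x y. 0 \<le> P x y"
  shows "0 \<le> nstep_prob P n x y"
  by (induction n arbitrary: x) (auto intro!: sum_nonneg mult_nonneg_nonneg assms)

text \<open>
  Accessibility depends only on the graph of positive entries, so it can be handled by induction on
  transitive closures.
\<close>

lemma leads_to_iff_trancl:
  assumes nonneg: "\<And>x y. 0 \<le> P x y"
  shows "leads_to P x y \<longleftrightarrow> (x, y) \<in> (edges P)\<^sup>+"
proof -
  have pos_Suc: "nstep_prob P (Suc n) x y > 0 \<longleftrightarrow> (\<exists>z. P x z > 0 \<and> nstep_prob P n z y > 0)"
    for n x
  proof -
    have "nstep_prob P (Suc n) x y > 0 \<longleftrightarrow> (\<exists>z\<in>UNIV. P x z * nstep_prob P n z y > 0)"
      by (auto simp: less_le sum_nonneg_eq_0_iff sum_nonneg nonneg nstep_prob_nonneg)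
    then show ?thesis
      using nonneg nstep_prob_nonneg[of P, OF nonneg] by (auto simp: zero_less_mult_iff not_less less_le)
  qed
  have "nstep_prob P n x y > 0 \<longleftrightarrow> (x, y) \<in> edges P ^^ n" for n
  proof (induction n arbitrary: x)
    case (Suc n)
    have "(x, y) \<in> edges P ^^ Suc n \<longleftrightarrow>
        (\<exists>z. (x, z) \<in> edges P \<and> (z, y) \<in> edges P ^^ n)"
      by (metis relpow_Suc_D2 relpow_Suc_I2)
    then show ?case unfolding pos_Suc Suc.IH by (simp add: edges_def)
  qed auto
  then show ?thesis
    by (auto simp: leads_to_def trancl_power Suc_le_eq)
qed

locale invariant_vector =
  fixes P :: "'x::finite \<Rightarrow> 'x \<Rightarrow> real" and p :: "'x \<Rightarrow> real"
  assumes P_nonneg: "0 \<le> P x y"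
    and P_sum: "(\<Sum>y\<in>UNIV. P x y) = 1"
    and p_nonneg: "0 \<le> p x"
    and p_sum: "(\<Sum>x\<in>UNIV. p x) = 1"
    and p_inv: "p y = (\<Sum>x\<in>UNIV. p x * P x y)"
begin

lemma charged_step:
  assumes "p x > 0" and "P x y > 0"
  shows "p y > 0"
proof -
  have "p x * P x y \<le> (\<Sum>x\<in>UNIV. p x * P x y)"
    by (rule member_le_sum) (auto simp: p_nonneg P_nonneg)
  with assms show ?thesis using p_inv[of y] by (smt (verit) mult_pos_pos)
qed

text \<open>
  Conservation of mass: the set \<open>A\<close> of states accessible from \<open>y\<close> is closed, so invariance leaves no
  room for any flow into \<open>A\<close> from outside. If \<open>x\<close> were not in \<open>A\<close>, the step from \<open>x\<close> to \<open>y\<close> would be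
  such a flow.
\<close>

lemma step_returns:
  assumes x: "p x > 0" and xy: "P x y > 0"
  shows "(y, x) \<in> (edges P)\<^sup>*"
proof (rule ccontr)
  assume no_return: "(y, x) \<notin> (edges P)\<^sup>*"
  define A where "A = (edges P)\<^sup>* `` {y}"
  have closed: "(\<Sum>b\<in>A. P a b) = 1" if "a \<in> A" for a
  proof -
    have "P a b = 0" if "b \<notin> A" for b
    proof (rule ccontr)
      assume "P a b \<noteq> 0"
      then have "(a, b) \<in> edges P" using P_nonneg[of a b] by (simp add: edges_def)
      then show False using \<open>a \<in> A\<close> \<open>b \<notin> A\<close> by (auto simp: A_def intro: rtrancl_into_rtrancl)
    qed
    then have "(\<Sum>b\<in>A. P a b) = (\<Sum>b\<in>UNIV. P a b)" by (intro sum.mono_neutral_left) auto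
    then show ?thesis by (simp add: P_sum)
  qed
  \<comment> \<open>The stationary flow into \<open>A\<close> from its complement.\<close>
  define F where "F = (\<Sum>a\<in>-A. p a * (\<Sum>b\<in>A. P a b))"
  have "(\<Sum>b\<in>A. p b) = (\<Sum>b\<in>A. \<Sum>a\<in>UNIV. p a * P a b)" by (rule sum.cong[OF refl p_inv])
  also have "\<dots> = (\<Sum>a\<in>UNIV. p a * (\<Sum>b\<in>A. P a b))"
    by (subst sum.swap) (simp add: sum_distrib_left)
  also have "\<dots> = (\<Sum>a\<in>A. p a * (\<Sum>b\<in>A. P a b)) + F"
    unfolding F_def Compl_eq_Diff_UNIV using sum.subset_diff[of A UNIV] by (simp add: add.commute)
  finally have "F = 0" using closed by simp
  moreover have "p x * P x y \<le> F"
  proof -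
    have "P x y \<le> (\<Sum>b\<in>A. P x b)"
      by (rule member_le_sum) (auto simp: A_def P_nonneg)
    then have "p x * P x y \<le> p x * (\<Sum>b\<in>A. P x b)" using p_nonneg by (rule mult_left_mono)
    also have "\<dots> \<le> F"
      unfolding F_def using no_return
      by (intro member_le_sum) (auto simp: A_def p_nonneg P_nonneg intro!: sum_nonneg mult_nonneg_nonneg)
    finally show ?thesis .
  qed
  ultimately show False using x xy by (smt (verit) mult_pos_pos)
qed

text \<open>
  Every single step out of a charged state ends in a charged state and can be undone, hence so can
  every path.
\<close>

lemma charged_recurrent:
  assumes "p x > 0"
  shows "recurrent P x"
proof -
  have returns: "p y > 0 \<and> (y, x) \<in> (edges P)\<^sup>*" if "(x, y) \<in> (edges P)\<^sup>*" for y
    using that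
  proof (induction rule: rtrancl_induct)
    case base
    show ?case using assms by simp
  next
    case (step y z)
    then have "P y z > 0" by (simp add: edges_def)
    then show ?case using step.IH charged_step step_returns by (meson rtrancl_trans)
  qed
  show ?thesis
    unfolding recurrent_def leads_to_iff_trancl[of P, OF P_nonneg]
  proof (intro allI impI)
    fix y assume xy: "(x, y) \<in> (edges P)\<^sup>+"
    then have "(y, x) \<in> (edges P)\<^sup>*" using returns by (simp add: trancl_into_rtrancl)
    then show "(y, x) \<in> (edges P)\<^sup>+" using xy by (metis rtranclD)
  qed
qed

lemma leads_to_itself:
  assumes "recurrent P x"
  shows "leads_to P x x"
proof -
  obtain y where "P x y > 0"
    using P_sum[of x] P_nonneg[of x] by (metis less_le sum.neutral zero_neq_one)
  then have xy: "leads_to P x y"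
    by (auto simp: leads_to_iff_trancl[of P, OF P_nonneg] edges_def)
  then have "leads_to P y x" using assms by (simp add: recurrent_def)
  then show ?thesis
    using xy unfolding leads_to_iff_trancl[of P, OF P_nonneg] by (rule trancl_trans[rotated])
qed

lemma recurrent_class_of:
  assumes "recurrent P x"
  shows "recurrent_class P {y. communicate P x y}"
  unfolding recurrent_class_def
proof (intro conjI ballI)
  show "\<exists>a\<in>{y. communicate P x y}. {y. communicate P x y} = {y. communicate P a y}"
    using leads_to_itself[OF assms] by (auto simp: communicate_def)
next
  fix y assume "y \<in> {y. communicate P x y}"
  then show "recurrent P y"
    using assms
    unfolding communicate_def recurrent_def leads_to_iff_trancl[of P, OF P_nonneg]
    by (blast intro: trancl_trans)
qed

text \<open>
  Two charged states are recurrent, so each generates a recurrent class; there is only one such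
  class.
\<close>

lemma charged_communicate:
  assumes unique: "\<exists>!C. recurrent_class P C" and "p x > 0" and "p y > 0"
  shows "(x, y) \<in> (edges P)\<^sup>+"
proof -
  have "{z. communicate P x z} = {z. communicate P y z}"
    using unique recurrent_class_of charged_recurrent assms(2,3) by blast
  moreover have "communicate P y y"
    using leads_to_itself charged_recurrent assms(3) by (simp add: communicate_def)
  ultimately have "communicate P x y" by blast
  then show ?thesis by (simp add: communicate_def leads_to_iff_trancl[of P, OF P_nonneg])
qed

end

section \<open>Path weights of a stationary chain and their lumping\<close>

definition path_weight :: "('x \<Rightarrow> real) \<Rightarrow> ('x \<Rightarrow> 'x \<Rightarrow> real) \<Rightarrow> 'x list \<Rightarrow> real" where
  "path_weight p P xs =
    (if xs = [] then 1 else p (hd xs) * (\<Prod>l<length xs - 1. P (xs ! l) (xs ! Suc l)))"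

lemma path_weight_Nil [simp]: "path_weight p P [] = 1"
  by (simp add: path_weight_def)

lemma path_weight_single [simp]: "path_weight p P [x] = p x"
  by (simp add: path_weight_def)

lemma path_weight_snoc:
  assumes "xs \<noteq> []"
  shows "path_weight p P (xs @ [y]) = path_weight p P xs * P (last xs) y"
proof -
  obtain n where n: "length xs = Suc n" using assms by (cases xs) auto
  then show ?thesis
    using assms by (simp add: path_weight_def nth_append last_conv_nth mult.assoc)
qed

text \<open>
  The law of the coordinatewise image under \<open>g\<close>, when \<open>q\<close> gives the word probabilities.
\<close>

definition lumped_weight ::
  "('x::finite \<Rightarrow> 'y) \<Rightarrow> ('x list \<Rightarrow> real) \<Rightarrow> 'y list \<Rightarrow> real" where
  "lumped_weight g q ys = (\<Sum>xs\<in>map g -` {ys}. q xs)"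

lemma finite_map_vimage: "finite (map (g :: 'x::finite \<Rightarrow> 'y) -` {ys})"
  by (rule finite_subset[OF _ finite_lists_length_eq[of "UNIV :: 'x set" "length ys"]])
    (auto dest: map_eq_imp_length_eq)

lemma map_vimage_append:
  "map g -` {us @ vs} = (\<lambda>(xs, ys). xs @ ys) ` (map g -` {us} \<times> map g -` {vs})"
  by (force simp: map_eq_append_conv)

lemma lumped_weight_append:
  "lumped_weight g q (us @ vs) = (\<Sum>xs\<in>map g -` {us}. \<Sum>ys\<in>map g -` {vs}. q (xs @ ys))"
proof -
  have "inj_on (\<lambda>(xs, ys). xs @ ys) (map g -` {us} \<times> map g -` {vs})"
    by (auto simp: inj_on_def dest!: map_eq_imp_length_eq)
  then show ?thesis
    unfolding lumped_weight_def map_vimage_append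
    by (simp add: sum.reindex sum.cartesian_product case_prod_unfold)
qed

lemma sum_over_letters:
  fixes g :: "'x::finite \<Rightarrow> 'y::finite"
  shows "(\<Sum>z\<in>UNIV. \<Sum>xs\<in>map g -` {[z]}. f xs) = (\<Sum>x\<in>UNIV. f [x])"
proof -
  have vim: "map g -` {[z]} = (\<lambda>x. [x]) ` {x. g x = z}" for z by auto
  have "(\<Sum>xs\<in>map g -` {[z]}. f xs) = (\<Sum>x | g x = z. f [x])" for z
    unfolding vim by (simp add: sum.reindex inj_on_def)
  then show ?thesis
    using sum.group[of UNIV UNIV g "\<lambda>x. f [x]"] by simp
qed

lemma stationary_word_law_lumped:
  fixes g :: "'x::finite \<Rightarrow> 'y::finite"
  assumes "stationary_word_law q"
  shows "stationary_word_law (lumped_weight g q)"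
proof -
  interpret stationary_word_law q by fact
  show ?thesis
  proof
    show "0 \<le> lumped_weight g q w" for w by (simp add: lumped_weight_def nonneg sum_nonneg)
    show "lumped_weight g q [] = 1" by (simp add: lumped_weight_def Nil_eq vimage_def)
    fix w :: "'y list"
    have "(\<Sum>z\<in>UNIV. lumped_weight g q ([z] @ w))
        = (\<Sum>z\<in>UNIV. \<Sum>ys\<in>map g -` {w}. \<Sum>xs\<in>map g -` {[z]}. q (xs @ ys))"
      unfolding lumped_weight_append by (intro sum.cong[OF refl] sum.swap)
    also have "\<dots> = (\<Sum>ys\<in>map g -` {w}. \<Sum>z\<in>UNIV. \<Sum>xs\<in>map g -` {[z]}. q (xs @ ys))"
      by (rule sum.swap)
    finally show "(\<Sum>z\<in>UNIV. lumped_weight g q (z # w)) = lumped_weight g q w"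
      by (simp add: sum_over_letters sum_Cons) (simp add: lumped_weight_def)
    have "(\<Sum>z\<in>UNIV. lumped_weight g q (w @ [z]))
        = (\<Sum>xs\<in>map g -` {w}. \<Sum>z\<in>UNIV. \<Sum>ys\<in>map g -` {[z]}. q (xs @ ys))"
      unfolding lumped_weight_append by (rule sum.swap)
    then show "(\<Sum>z\<in>UNIV. lumped_weight g q (w @ [z])) = lumped_weight g q w"
      by (simp add: sum_over_letters sum_snoc) (simp add: lumped_weight_def)
  qed
qed

context invariant_vector
begin

lemma stationary_word_law_path_weight: "stationary_word_law (path_weight p P)"
proof
  show "0 \<le> path_weight p P w" for w
    by (simp add: path_weight_def p_nonneg P_nonneg prod_nonneg)
  show "path_weight p P [] = 1" by simp
  show "(\<Sum>z\<in>UNIV. path_weight p P (w @ [z])) = path_weight p P w" for w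
    by (cases "w = []") (simp_all add: p_sum P_sum path_weight_snoc flip: sum_distrib_left)
  show "(\<Sum>z\<in>UNIV. path_weight p P (z # w)) = path_weight p P w" for w
  proof (cases w)
    case Nil
    then show ?thesis by (simp add: p_sum)
  next
    case (Cons y w')
    have "path_weight p P (z # w)
        = (p z * P z y) * (\<Prod>l<length w - 1. P (w ! l) (w ! Suc l))" for z
      unfolding Cons by (simp add: path_weight_def prod.lessThan_Suc_shift del: prod.lessThan_Suc)
    then have "(\<Sum>z\<in>UNIV. path_weight p P (z # w))
        = (\<Sum>z\<in>UNIV. p z * P z y) * (\<Prod>l<length w - 1. P (w ! l) (w ! Suc l))"
      by (simp add: sum_distrib_right)
    then show ?thesis using p_inv[of y] Cons by (simp add: path_weight_def)
  qed
qed

sublocale path: stationary_word_law "path_weight p P"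
  by (rule stationary_word_law_path_weight)

text \<open>
  The two paths share the state \<open>y\<close>. Beyond it, the steps of the second path have positive
  probability irrespective of the past, which is the Markov property; this step has no analogue for
  the lumped weights, so irreducibility has to be shown before lumping.
\<close>

lemma path_weight_glue:
  assumes "path_weight p P (xs @ [y]) > 0" and "path_weight p P (y # ys) > 0"
  shows "path_weight p P (xs @ y # ys) > 0"
  using assms(2)
proof (induction ys rule: rev_induct)
  case Nil
  show ?case using assms(1) by simp
next
  case (snoc z ys)
  let ?s = "P (last (y # ys)) z"
  have "path_weight p P (y # ys) * ?s > 0"
    using snoc.prems path_weight_snoc[of "y # ys" p P z] by simp
  moreover have "path_weight p P (y # ys) > 0"
    using snoc.prems path.prefix_pos[of "y # ys" "[z]"] by simp
  ultimately have "?s > 0" by (simp add: zero_less_mult_iff)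
  then show ?case
    using snoc.IH \<open>path_weight p P (y # ys) > 0\<close> path_weight_snoc[of "xs @ y # ys" p P z]
    by simp
qed

lemma path_weight_extend:
  assumes xs: "xs \<noteq> []" "path_weight p P xs > 0"
    and "(last xs, y) \<in> (edges P)\<^sup>+"
  shows "\<exists>us. path_weight p P (xs @ us @ [y]) > 0"
  using assms(3)
proof (induction rule: trancl_induct)
  case (base y)
  then have "path_weight p P (xs @ [] @ [y]) > 0"
    using xs by (simp add: path_weight_snoc edges_def)
  then show ?case by blast
next
  case (step y z)
  then obtain us where us: "path_weight p P (xs @ us @ [y]) > 0" by blast
  then have "path_weight p P ((xs @ us @ [y]) @ [z]) > 0"
    using step.hyps by (subst path_weight_snoc) (simp_all add: edges_def)
  then have "path_weight p P (xs @ (us @ [y]) @ [z]) > 0" by simp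
  then show ?case by blast
qed

lemma path_weight_irreducible:
  assumes unique: "\<exists>!C. recurrent_class P C"
    and xs: "xs \<noteq> []" "path_weight p P xs > 0"
    and ys: "ys \<noteq> []" "path_weight p P ys > 0"
  shows "\<exists>us. path_weight p P (xs @ us @ ys) > 0"
proof -
  obtain y ys' where y: "ys = y # ys'" using ys(1) by (cases ys) auto
  have "p (last xs) > 0"
    using path.suffix_pos[of "butlast xs" "[last xs]"] xs by simp
  moreover have "p y > 0"
    using path.prefix_pos[of "[y]" ys'] ys y by simp
  ultimately have "(last xs, y) \<in> (edges P)\<^sup>+"
    using charged_communicate[OF unique] by blast
  then obtain us where "path_weight p P ((xs @ us) @ [y]) > 0"
    using path_weight_extend[OF xs] by auto
  from path_weight_glue[OF this] show ?thesis using ys(2) y by auto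
qed

lemma lumped_path_weight_irreducible:
  fixes g :: "'x \<Rightarrow> 'y::finite"
  assumes unique: "\<exists>!C. recurrent_class P C"
    and v: "v \<noteq> []" "lumped_weight g (path_weight p P) v > 0"
    and w: "w \<noteq> []" "lumped_weight g (path_weight p P) w > 0"
  shows "\<exists>u. lumped_weight g (path_weight p P) (v @ u @ w) > 0"
proof -
  have pos_iff: "lumped_weight g (path_weight p P) u > 0
      \<longleftrightarrow> (\<exists>xs. map g xs = u \<and> path_weight p P xs > 0)" for u
    unfolding lumped_weight_def
    by (auto simp: less_le sum_nonneg_eq_0_iff sum_nonneg path.nonneg finite_map_vimage)
  obtain xs ys where "map g xs = v" "path_weight p P xs > 0" "map g ys = w" "path_weight p P ys > 0"
    using v w pos_iff by blast
  moreover from this have "xs \<noteq> []" "ys \<noteq> []" using v w by auto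
  ultimately obtain us where "path_weight p P (xs @ us @ ys) > 0"
    using path_weight_irreducible[OF unique] by blast
  then have "lumped_weight g (path_weight p P) (map g (xs @ us @ ys)) > 0"
    unfolding pos_iff by blast
  then show ?thesis using \<open>map g xs = v\<close> \<open>map g ys = w\<close> by auto
qed

end

section \<open>Word probabilities of the chain and of its image\<close>

lemma length_block [simp]: "length (block z m n) = n - m"
  by (simp add: block_def)

lemma block_snoc: "block z 0 (Suc n) = block z 0 n @ [z n]"
  by (simp add: block_def)

lemma block_measurable [measurable]:
  fixes X :: "nat \<Rightarrow> 'a \<Rightarrow> 'x::finite"
  assumes [measurable]: "\<And>n. X n \<in> measurable M (count_space UNIV)"
  shows "{\<omega> \<in> space M. block (\<lambda>i. X i \<omega>) 0 n = xs} \<in> sets M"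
proof (induction n arbitrary: xs)
  case 0
  show ?case by (simp add: block_def)
next
  case (Suc n)
  show ?case
  proof (cases xs rule: rev_cases)
    case Nil
    then show ?thesis by (simp add: block_snoc)
  next
    case (snoc us x)
    have "{\<omega> \<in> space M. block (\<lambda>i. X i \<omega>) 0 (Suc n) = xs} =
        {\<omega> \<in> space M. block (\<lambda>i. X i \<omega>) 0 n = us} \<inter> {\<omega> \<in> space M. X n \<omega> = x}"
      by (auto simp: snoc block_snoc)
    moreover have "{\<omega> \<in> space M. X n \<omega> = x} \<in> sets M" by measurable
    ultimately show ?thesis using Suc.IH[of us] by (simp add: sets.Int)
  qed
qed

text \<open>
  The chain rule. The Markov identities constrain the chain only after histories of positive
  probability; after a null history both sides vanish.
\<close>

lemma markov_chain_word_prob: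
  fixes X :: "nat \<Rightarrow> 'a \<Rightarrow> 'x::finite"
  assumes chain: "homogeneous_markov_chain 1 M X (first_order P)"
    and init: "\<And>x. \<P>(\<omega> in M. X 0 \<omega> = x) = p x"
  shows "\<P>(\<omega> in M. block (\<lambda>i. X i \<omega>) 0 (length xs) = xs) = path_weight p P xs"
proof (induction xs rule: rev_induct)
  case Nil
  interpret prob_space M using chain by (simp add: homogeneous_markov_chain_def)
  show ?case by (simp add: block_def prob_space)
next
  case (snoc y xs)
  interpret prob_space M using chain by (simp add: homogeneous_markov_chain_def)
  have [measurable]: "X n \<in> measurable M (count_space UNIV)" for n
    using chain by (simp add: homogeneous_markov_chain_def)
  show ?case
  proof (cases "xs = []")
    case True
    then show ?thesis using init by (simp add: block_def)
  next
    case False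
    define n where "n = length xs"
    let ?B = "{\<omega> \<in> space M. block (\<lambda>i. X i \<omega>) 0 n = xs}"
    let ?B' = "{\<omega> \<in> space M. X n \<omega> = y \<and> block (\<lambda>i. X i \<omega>) 0 n = xs}"
    have n: "n \<ge> 1" using False by (simp add: n_def Suc_le_eq)
    have ext: "{\<omega> \<in> space M. block (\<lambda>i. X i \<omega>) 0 (length (xs @ [y])) = xs @ [y]} = ?B'"
      by (auto simp: n_def block_snoc)
    have "prob ?B' = prob ?B * P (last xs) y"
    proof (cases "prob ?B > 0")
      case True
      define z where "z = (!) (xs @ [y])"
      have z: "block z 0 n = xs" "z n = y"
        by (auto simp: z_def block_def n_def nth_append intro!: nth_equalityI)
      have "block z (n - 1) n = [z (n - 1)]"
        using n by (cases n) (auto simp: block_def)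
      also have "z (n - 1) = last xs"
        using n False by (simp add: z_def n_def nth_append last_conv_nth)
      finally have "block z (n - 1) n = [last xs]" .
      then have "\<P>(\<omega> in M. X n \<omega> = z n \<bar> block (\<lambda>i. X i \<omega>) 0 n = block z 0 n) = P (last xs) y"
        using chain n True z unfolding homogeneous_markov_chain_def first_order_def by force
      then show ?thesis using True by (simp add: z cond_prob_def field_simps)
    next
      case False
      then have "prob ?B = 0" using measure_nonneg[of M ?B] by linarith
      moreover have "prob ?B' \<le> prob ?B" by (rule finite_measure_mono) auto
      ultimately show ?thesis using measure_nonneg[of M ?B'] by simp
    qed
    then show ?thesis
      using snoc.IH False unfolding ext by (simp add: path_weight_snoc n_def)
  qed
qed

lemma lumped_word_prob:
  fixes X :: "nat \<Rightarrow> 'a \<Rightarrow> 'x::finite"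
  assumes "prob_space M" and X: "\<And>n. X n \<in> measurable M (count_space UNIV)"
    and Y: "\<And>n \<omega>. Y n \<omega> = g (X n \<omega>)"
  shows "\<P>(\<omega> in M. block (\<lambda>i. Y i \<omega>) 0 n = ys)
    = lumped_weight g (\<lambda>xs. \<P>(\<omega> in M. block (\<lambda>i. X i \<omega>) 0 n = xs)) ys"
proof -
  interpret prob_space M by fact
  let ?E = "\<lambda>xs. {\<omega> \<in> space M. block (\<lambda>i. X i \<omega>) 0 n = xs}"
  have "{\<omega> \<in> space M. block (\<lambda>i. Y i \<omega>) 0 n = ys} = (\<Union>xs\<in>map g -` {ys}. ?E xs)"
    by (auto simp: block_def Y o_def)
  moreover have "prob (\<Union>xs\<in>map g -` {ys}. ?E xs) = (\<Sum>xs\<in>map g -` {ys}. prob (?E xs))"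
    by (rule finite_measure_finite_Union)
      (auto simp: finite_map_vimage disjoint_family_on_def block_measurable[OF X])
  ultimately show ?thesis by (simp add: lumped_weight_def)
qed

theorem theorem1:
  fixes k :: nat
    and M :: "'a measure" and X :: "nat \<Rightarrow> 'a \<Rightarrow> 'x::finite"
    and P :: "'x \<Rightarrow> 'x \<Rightarrow> real" and \<pi> :: "'x pmf"
    and g :: "'x \<Rightarrow> 'y::finite" and Y :: "nat \<Rightarrow> 'a \<Rightarrow> 'y"
    and N :: "'b measure" and Z :: "nat \<Rightarrow> 'b \<Rightarrow> 'y" and Q :: "'y list \<Rightarrow> 'y \<Rightarrow> real"
  assumes "k \<ge> 1"
    and "1 < CARD('y)" and "CARD('y) \<le> CARD('x)"
    and "homogeneous_markov_chain 1 M X (first_order P)"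
    and "\<exists>!C. recurrent_class P C"
    and "invariant_distribution 1 (first_order P) (map_pmf (\<lambda>x. [x]) \<pi>)"
    and "\<forall>x. \<P>(\<omega> in M. X 0 \<omega> = x) = pmf \<pi> x"
    and "\<forall>n \<omega>. Y n \<omega> = g (X n \<omega>)"
    and "markov_approximation k M Y N Z Q"
  shows "\<exists>\<mu>. invariant_distribution k Q \<mu> \<and>
    (\<forall>\<nu>. invariant_distribution k Q \<nu> \<longrightarrow> \<nu> = \<mu>) \<and>
    (\<forall>ys. length ys = k \<longrightarrow>
       pmf \<mu> ys = \<P>(\<omega> in M. block (\<lambda>i. Y i \<omega>) 0 k = ys) \<and>
       \<P>(\<omega> in M. block (\<lambda>i. Y i \<omega>) 0 k = ys)
         = (\<Sum>xs\<in>map g -` {ys}. pmf \<pi> (xs ! 0) * (\<Prod>l=1..k-1. P (xs ! (l - 1)) (xs ! l))))"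
proof -
  note chain = assms(4) and approx = assms(9)
  interpret M: prob_space M using chain by (simp add: homogeneous_markov_chain_def)
  have meas: "X n \<in> measurable M (count_space UNIV)" for n
    using chain by (simp add: homogeneous_markov_chain_def)
  have P: "0 \<le> P x y" "(\<Sum>y\<in>UNIV. P x y) = 1" for x y
  proof -
    have "row_stochastic 1 (first_order P)" using chain by (simp add: homogeneous_markov_chain_def)
    then have "(\<forall>z. 0 \<le> first_order P [x] z) \<and> (\<Sum>z\<in>UNIV. first_order P [x] z) = 1"
      unfolding row_stochastic_def by simp
    then show "0 \<le> P x y" "(\<Sum>y\<in>UNIV. P x y) = 1" by (simp_all add: first_order_def)
  qed
  have inv: "pmf \<pi> y = (\<Sum>x\<in>UNIV. pmf \<pi> x * P x y)" for y
  proof -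
    have "pmf (map_pmf (\<lambda>x. [x]) \<pi>) [x] = pmf \<pi> x" for x
      by (rule pmf_map_inj') (simp add: inj_on_def)
    moreover have "pmf (map_pmf (\<lambda>x. [x]) \<pi>) [y] = (\<Sum>x\<in>UNIV.
        pmf (map_pmf (\<lambda>x. [x]) \<pi>) (x # butlast [y])
          * first_order P (x # butlast [y]) (last [y]))"
      using assms(6) unfolding invariant_distribution_def by (elim conjE allE[of _ "[y]"]) simp
    ultimately show ?thesis by (simp only: butlast.simps last.simps first_order_def list.sel if_True simp_thms)
  qed
  have "(\<Sum>x\<in>UNIV. pmf \<pi> x) = 1" by (rule sum_pmf_eq_1) auto
  with P inv interpret invariant_vector P "pmf \<pi>" by (intro invariant_vector.intro pmf_nonneg)
  define q where "q = lumped_weight g (path_weight (pmf \<pi>) P)"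
  have len: "length xs = length ys" if "xs \<in> map g -` {ys}" for xs ys
    using that by auto
  have word_prob: "\<P>(\<omega> in M. block (\<lambda>i. Y i \<omega>) 0 n = ys) = q ys" if "length ys = n" for n ys
  proof -
    have "\<P>(\<omega> in M. block (\<lambda>i. X i \<omega>) 0 n = xs) = path_weight (pmf \<pi>) P xs"
      if "xs \<in> map g -` {ys}" for xs
      using markov_chain_word_prob[OF chain, of "pmf \<pi>" xs] assms(7) len[OF that] \<open>length ys = n\<close>
      by simp
    then show ?thesis
      using lumped_word_prob[OF M.prob_space_axioms meas, where Y = Y and g = g and n = n and ys = ys] assms(8)
      by (simp add: q_def lumped_weight_def)
  qed
  interpret approx: word_law_approximation q k Q
  proof (intro word_law_approximation.intro word_law_approximation_axioms.intro)
    show "stationary_word_law q"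
      unfolding q_def by (intro stationary_word_law_lumped stationary_word_law_path_weight)
    show "k \<ge> 1" by fact
    show "\<exists>u. q (v @ u @ w) > 0" if "v \<noteq> []" "w \<noteq> []" "q v > 0" "q w > 0" for v w
      using that lumped_path_weight_irreducible[OF assms(5)] by (simp add: q_def)
    show "Q w z = (if q w > 0 then q (w @ [z]) / q w else 1 / real CARD('y))"
      if "length w = k" for w z
      using approx that by (simp add: markov_approximation_def word_prob)
  qed
  have weight: "path_weight (pmf \<pi>) P xs
      = pmf \<pi> (xs ! 0) * (\<Prod>l=1..k-1. P (xs ! (l - 1)) (xs ! l))" if "length xs = k" for xs
  proof -
    have "{1..k - 1} = Suc ` {..<k - 1}" by (auto simp: image_Suc_lessThan)
    then have "(\<Prod>l=1..k-1. P (xs ! (l - 1)) (xs ! l)) = (\<Prod>l<k - 1. P (xs ! l) (xs ! Suc l))"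
      by (simp add: prod.reindex)
    moreover have "xs \<noteq> []" using that \<open>k \<ge> 1\<close> by auto
    ultimately show ?thesis using that by (simp add: path_weight_def hd_conv_nth)
  qed
  show ?thesis
  proof (intro exI[of _ "approx.word_pmf k"] conjI allI impI)
    show "invariant_distribution k Q (approx.word_pmf k)" by (rule approx.word_pmf_invariant)
    show "\<nu> = approx.word_pmf k" if "invariant_distribution k Q \<nu>" for \<nu>
      using that by (rule approx.invariant_distribution_unique)
    fix ys :: "'y list"
    assume ys: "length ys = k"
    then show "pmf (approx.word_pmf k) ys = \<P>(\<omega> in M. block (\<lambda>i. Y i \<omega>) 0 k = ys)"
      by (simp add: approx.pmf_word_pmf word_prob)
    show "\<P>(\<omega> in M. block (\<lambda>i. Y i \<omega>) 0 k = ys)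
        = (\<Sum>xs\<in>map g -` {ys}. pmf \<pi> (xs ! 0) * (\<Prod>l=1..k-1. P (xs ! (l - 1)) (xs ! l)))"
      unfolding word_prob[OF ys] q_def lumped_weight_def
      by (rule sum.cong[OF refl], rule weight) (use len ys in auto)
  qed
qed

end
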